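(* Let $k\geq 4$ be an integer and let $\mathbf{x}=\mathbf{x}_k$ be the binary sequence defined in the context. Then the critical exponent of $\mathbf{x}$ equals $k+1$, and it is attained by the factors $0^{k+1}$ and $1^{k+1}$ of $\mathbf{x}$. Moreover, for no integer $n\geq 1$ does $\mathbf{x}$ contain a factor of length $2n+k$ having period $n$; consequently the asymptotic critical exponent of $\mathbf{x}$ equals $2$.
   Context: Fix an integer $k\geq 4$. Let $\mathcal{A}=\{0,1,\ldots,k-1,0',1',\ldots,(k-1)'\}$. Let $\xi=\xi_k:\mathcal{A}^*\to\mathcal{A}^*$ be the morphism given by $\xi(0)=01$, $\xi(j)=j+1$ for $1\leq j\leq k-2$, $\xi(k-1)=0'$, and $\xi(0')=0'1'$, $\xi(j')=(j+1)'$ for $1\leq j\leq k-2$, $\xi((k-1)')=0$. Let $\mathbf{u}=\xi^\omega(0)$ be the infinite fixed point of $\xi$ starting with $0$. Let $\pi:\mathcal{A}^*\to\{0,1\}^*$ be the letter-to-letter morphism with $\pi(0)=0$, $\pi(j')=0$ for $1\leq j\leq k-1$, $\pi(0')=1$, $\pi(j)=1$ for $1\leq j\leq k-1$. Put $\mathbf{x}=\pi(\mathbf{u})$. A word $z$ of length $p$ has period $q\geq 1$ if $z$ is a prefix of $u^\omega$ for some word $u$ of length $q$; then we write $z=u^{p/q}$. The critical exponent of an infinite word $\mathbf{v}$ is $E(\mathbf{v})=\sup\{r\in\mathbb{Q}: u^r \text{ is a non-empty factor of }\mathbf{v}\}$, and (when finite) the asymptotic critical exponent is $E^*(\mathbf{v})=\lim_{n\to\infty}\sup\{r\in\mathbb{Q}: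 u^r\text{ is a non-empty factor of }\mathbf{v}\text{ with }|u|\geq n\}$. *)

theory Defs
  imports Complex_Main "HOL-Library.Extended_Real" "HOL-Library.Omega_Words_Fun"
begin

definition is_factor :: "'a list \<Rightarrow> 'a word \<Rightarrow> bool"
  where "is_factor z v \<longleftrightarrow> (\<exists>i. z = v [i \<rightarrow> i + length z])"

definition has_period :: "'a list \<Rightarrow> nat \<Rightarrow> bool"
  where "has_period z q \<longleftrightarrow>
    q \<ge> 1 \<and> (\<exists>u. length u = q \<and> z = prefix (length z) (u\<^sup>\<omega>))"

text \<open>\<open>is_rat_power z u r\<close> renders \<open>z = u\<^sup>r\<close>; exponents below 1 are allowed.\<close>

definition is_rat_power :: "'a list \<Rightarrow> 'a list \<Rightarrow> rat \<Rightarrow> bool"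
  where "is_rat_power z u r \<longleftrightarrow>
    u \<noteq> [] \<and> r = of_nat (length z) / of_nat (length u) \<and> z = prefix (length z) (u\<^sup>\<omega>)"

text \<open>The suprema are taken in the extended reals, where they always exist.\<close>

definition critical_exponent :: "'a word \<Rightarrow> ereal"
  where "critical_exponent v =
    Sup {ereal (real_of_rat r) | r u z. is_rat_power z u r \<and> z \<noteq> [] \<and> is_factor z v}"

definition exponent_sup_from :: "'a word \<Rightarrow> nat \<Rightarrow> ereal"
  where "exponent_sup_from v n =
    Sup {ereal (real_of_rat r) | r u z.
      is_rat_power z u r \<and> z \<noteq> [] \<and> is_factor z v \<and> length u \<ge> n}"

definition asymptotic_critical_exponent :: "'a word \<Rightarrow> ereal"
  where "asymptotic_critical_exponent v = lim (exponent_sup_from v)"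

lemma asymptotic_critical_exponent_tendsto:
  "exponent_sup_from v \<longlonglongrightarrow> asymptotic_critical_exponent v"
proof -
  have "decseq (exponent_sup_from v)"
    unfolding decseq_def exponent_sup_from_def by (intro allI impI Sup_subset_mono) fastforce
  then have "exponent_sup_from v \<longlonglongrightarrow> (INF n. exponent_sup_from v n)"
    by (rule LIMSEQ_INF)
  then show ?thesis
    unfolding asymptotic_critical_exponent_def using limI by metis
qed


datatype letter = Plain nat | Primed nat

definition alphabet :: "nat \<Rightarrow> letter set"
  where "alphabet k = Plain ` {..<k} \<union> Primed ` {..<k}"

text \<open>
  The morphisms are given by their values on single letters; the values outside
  \<open>alphabet k\<close> are irrelevant, see \<open>u_word_in_alphabet\<close>.
\<close>

fun xi_letter :: "nat \<Rightarrow> letter \<Rightarrow> letter list"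
  where
    "xi_letter k (Plain j) =
      (if j = 0 then [Plain 0, Plain 1]
       else if j = k - 1 then [Primed 0]
       else [Plain (j + 1)])"
  | "xi_letter k (Primed j) =
      (if j = 0 then [Primed 0, Primed 1]
       else if j = k - 1 then [Plain 0]
       else [Primed (j + 1)])"

definition xi :: "nat \<Rightarrow> letter list \<Rightarrow> letter list"
  where "xi k w = concat (map (xi_letter k) w)"

text \<open>
  Each iterate \<open>(xi k ^^ n) [Plain 0]\<close> is a prefix of the next one and has length greater
  than \<open>n\<close>, so the following is the limit word; see \<open>xi_iterate_prefix_u_word\<close> and
  \<open>xi_fixes_u_word\<close>.
\<close>

definition u_word :: "nat \<Rightarrow> letter word"
  where "u_word k = (\<lambda>n. ((xi k ^^ n) [Plain 0]) ! n)"

fun pi_letter :: "letter \<Rightarrow> nat"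
  where
    "pi_letter (Plain j) = (if j = 0 then 0 else 1)"
  | "pi_letter (Primed j) = (if j = 0 then 1 else 0)"

definition x_word :: "nat \<Rightarrow> nat word"
  where "x_word k = pi_letter \<circ> u_word k"


lemma xi_append: "xi k (v @ w) = xi k v @ xi k w"
  by (simp add: xi_def)

lemma xi_letter_nonempty: "xi_letter k a \<noteq> []"
  by (cases a) auto

lemma length_xi: "length w \<le> length (xi k w)"
proof (induction w)
  case (Cons a w)
  have "length (xi_letter k a) \<ge> 1"
    using xi_letter_nonempty[of k a] by (cases "xi_letter k a") auto
  with Cons show ?case by (simp add: xi_def)
qed (simp add: xi_def)

lemma xi_iterate_head: "\<exists>w. (xi k ^^ n) [Plain 0] = Plain 0 # w \<and> length w \<ge> n"
proof (induction n)
  case (Suc n)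
  then obtain w where w: "(xi k ^^ n) [Plain 0] = Plain 0 # w" "length w \<ge> n"
    by blast
  have "(xi k ^^ Suc n) [Plain 0] = Plain 0 # (Plain 1 # xi k w)"
    using w by (simp add: xi_def)
  moreover have "length (Plain 1 # xi k w) \<ge> Suc n"
    using w length_xi[of w k] by simp
  ultimately show ?case by blast
qed simp

lemma length_xi_iterate: "n < length ((xi k ^^ n) [Plain 0])"
  using xi_iterate_head[of n k] by auto

lemma xi_iterate_Suc: "\<exists>v. (xi k ^^ Suc n) [Plain 0] = (xi k ^^ n) [Plain 0] @ v"
proof (induction n)
  case 0
  show ?case by (simp add: xi_def)
next
  case (Suc n)
  then obtain v where "(xi k ^^ Suc n) [Plain 0] = (xi k ^^ n) [Plain 0] @ v"
    by blast
  then have "xi k ((xi k ^^ Suc n) [Plain 0]) = xi k ((xi k ^^ n) [Plain 0]) @ xi k v"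
    by (simp only: xi_append)
  then show ?case by auto
qed

lemma xi_iterate_mono:
  assumes "m \<le> n"
  shows "\<exists>v. (xi k ^^ n) [Plain 0] = (xi k ^^ m) [Plain 0] @ v"
  using assms
proof (induction n rule: dec_induct)
  case (step n)
  then show ?case using xi_iterate_Suc[of n k] by (metis append.assoc)
qed simp

lemma xi_iterate_nth:
  assumes "i < length ((xi k ^^ n) [Plain 0])"
  shows "((xi k ^^ n) [Plain 0]) ! i = u_word k i"
proof (cases "n \<le> i")
  case True
  then show ?thesis
    using xi_iterate_mono[OF True, of k] assms by (auto simp: u_word_def nth_append)
next
  case False
  then show ?thesis
    using xi_iterate_mono[of i n k] length_xi_iterate[of i k]
    by (auto simp: u_word_def nth_append)
qed

lemma xi_iterate_prefix_u_word:
  "(xi k ^^ n) [Plain 0] = prefix (length ((xi k ^^ n) [Plain 0])) (u_word k)"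
  by (rule nth_equalityI) (simp_all add: xi_iterate_nth)

lemma xi_fixes_u_word:
  "xi k (prefix n (u_word k)) = prefix (length (xi k (prefix n (u_word k)))) (u_word k)"
proof -
  let ?w = "(xi k ^^ n) [Plain 0]"
  have "prefix n (u_word k) = take n ?w"
    using length_xi_iterate[of n k] by (subst xi_iterate_prefix_u_word) (simp add: min_def)
  then have "?w = prefix n (u_word k) @ drop n ?w"
    by simp
  then have "xi k ?w = xi k (prefix n (u_word k)) @ xi k (drop n ?w)"
    by (metis xi_append)
  moreover have "xi k ?w = prefix (length (xi k ?w)) (u_word k)"
    using xi_iterate_prefix_u_word[of "Suc n" k] by simp
  ultimately have "xi k (prefix n (u_word k)) =
      take (length (xi k (prefix n (u_word k)))) (prefix (length (xi k ?w)) (u_word k))"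
    and "length (xi k (prefix n (u_word k))) \<le> length (xi k ?w)"
    by (metis append_eq_conv_conj, simp)
  then show ?thesis
    by (simp add: min_def)
qed

lemma u_word_in_alphabet:
  assumes "k \<ge> 2"
  shows "u_word k i \<in> alphabet k"
proof -
  have letter: "set (xi_letter k a) \<subseteq> alphabet k" if "a \<in> alphabet k" for a
    using that assms by (auto simp: alphabet_def split: if_splits)
  have "set ((xi k ^^ n) [Plain 0]) \<subseteq> alphabet k" for n
  proof (induction n)
    case 0
    show ?case using assms by (simp add: alphabet_def)
  next
    case (Suc n)
    then show ?case using letter by (auto simp: xi_def)
  qed
  then show ?thesis
    using length_xi_iterate[of i k] unfolding u_word_def by (meson nth_mem subsetD)
qed

end

theory Submission
  imports Defs
begin

text \<open>
  The word \<open>u\<close> is overlap-free: since the images of distinct letters end in distinct letters, an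
  overlap in \<open>u\<close> desubstitutes to an overlap occurring earlier in the iteration, unless it arises
  from a square \<open>w w\<close> followed by \<open>k - 1\<close> with \<open>w\<close> starting with \<open>0'\<close> (or the same with primes
  exchanged). Such an extended square is excluded by desubstituting it further, about \<open>2 * k\<close>
  times, until a letter \<open>0\<close> or \<open>0'\<close> with impossible neighbours appears.

  A letter of \<open>u\<close> is determined by its image in \<open>x\<close> together with the \<open>k - 1\<close> images to its left and
  the two to its right. Hence a factor of \<open>x\<close> with period \<open>n\<close> and length \<open>2 * n + k\<close> lifts to a factor of
  \<open>u\<close> in which only the last two of the \<open>n + 1\<close> comparisons at distance \<open>n\<close> may fail. If none fails, there
  is an overlap in \<open>u\<close>; otherwise the few ways to fail lead to an extended square as above or
  contradict the rule about the neighbours of a block \<open>0 1 \<dots> j\<close> of \<open>u\<close>. Long squares, on the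
  other hand, are the images of the factor \<open>0 0\<close> of \<open>u\<close> under the iterates of \<open>xi\<close>.
\<close>

text \<open>Carrying the prime as a boolean turns the symmetry between plain and primed letters into
  negation of \<open>b\<close>, so that each argument is made once for both halves of the
  alphabet.\<close>

definition lit :: "bool \<Rightarrow> nat \<Rightarrow> letter"
  where "lit b j = (if b then Primed j else Plain j)"

lemma lit_eq_iff [simp]: "lit b i = lit c j \<longleftrightarrow> b = c \<and> i = j"
  by (auto simp: lit_def)

lemma lit_cases: obtains b j where "a = lit b j"
proof (cases a)
  case (Plain j)
  then show ?thesis using that[of False j] by (simp add: lit_def)
next
  case (Primed j)
  then show ?thesis using that[of True j] by (simp add: lit_def)
qed

lemma Plain_eq_lit: "Plain j = lit False j"
  by (simp add: lit_def)

lemma lit_in_alphabet_iff: "lit b j \<in> alphabet k \<longleftrightarrow> j < k"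
  by (auto simp: alphabet_def lit_def)

lemma xi_letter_lit:
  "xi_letter k (lit b j) =
    (if j = 0 then [lit b 0, lit b 1] else if j = k - 1 then [lit (\<not> b) 0] else [lit b (j + 1)])"
  by (simp add: lit_def)

lemma pi_letter_lit: "pi_letter (lit b j) = of_bool (b \<longleftrightarrow> j = 0)"
  by (simp add: lit_def)

lemma pi_letter_eq_iff:
  "pi_letter (lit b i) = pi_letter (lit c j) \<longleftrightarrow> (b \<longleftrightarrow> i = 0) = (c \<longleftrightarrow> j = 0)"
  by (simp add: pi_letter_lit of_bool_eq_iff)

text \<open>
  The \<open>2 * k\<close> letters are arranged in a cycle, on which \<open>xi\<close> acts by moving the last letter of a
  word one step ahead.
\<close>

fun next_letter :: "nat \<Rightarrow> letter \<Rightarrow> letter"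
  where
    "next_letter k (Plain j) = (if j = k - 1 then Primed 0 else Plain (j + 1))"
  | "next_letter k (Primed j) = (if j = k - 1 then Plain 0 else Primed (j + 1))"

lemma next_letter_lit:
  "next_letter k (lit b j) = (if j = k - 1 then lit (\<not> b) 0 else lit b (j + 1))"
  by (simp add: lit_def)

text \<open>
  The letters \<open>lit b 1\<close> are exactly those that only occur inside an image \<open>xi_letter k a\<close>, never as
  its first letter; a word is cut into images before all other letters.
\<close>

definition starts_image :: "letter \<Rightarrow> bool"
  where "starts_image a \<longleftrightarrow> (\<forall>b. a \<noteq> lit b 1)"

lemma starts_image_lit [simp]: "starts_image (lit b j) \<longleftrightarrow> j \<noteq> 1"
  by (auto simp: starts_image_def)

text \<open>Factors are taken in a finite iterate rather than in \<open>u_word\<close>: each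
  desubstitution lowers \<open>n\<close> by one, which makes induction on \<open>n\<close>
  available.\<close>

definition iterate_factor :: "nat \<Rightarrow> nat \<Rightarrow> letter list \<Rightarrow> bool"
  where "iterate_factor k n w \<longleftrightarrow> (\<exists>p s. (xi k ^^ n) [Plain 0] = p @ w @ s)"

lemma iterate_factor_middle: "iterate_factor k n (p @ w @ s) \<Longrightarrow> iterate_factor k n w"
  unfolding iterate_factor_def by (metis append.assoc)

lemma iterate_factor_left: "iterate_factor k n (w @ s) \<Longrightarrow> iterate_factor k n w"
  using iterate_factor_middle[of k n "[]"] by simp

lemma iterate_factor_right: "iterate_factor k n (p @ w) \<Longrightarrow> iterate_factor k n w"
  using iterate_factor_middle[of k n p w "[]"] by simp

lemma xi_Nil [simp]: "xi k [] = []"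
  by (simp add: xi_def)

lemma xi_Cons: "xi k (a # w) = xi_letter k a @ xi k w"
  by (simp add: xi_def)

lemma hd_xi_Cons: "hd (xi k (a # w)) = hd (xi_letter k a)"
  by (simp add: xi_Cons xi_letter_nonempty)

lemma xi_eq_Nil_iff [simp]: "xi k w = [] \<longleftrightarrow> w = []"
  by (cases w) (simp_all add: xi_Cons xi_letter_nonempty)

lemma xi_power_append: "(xi k ^^ m) (v @ w) = (xi k ^^ m) v @ (xi k ^^ m) w"
  by (induction m) (simp_all add: xi_append)

lemma iterate_factor_xi_power:
  assumes "iterate_factor k n w"
  shows "iterate_factor k (m + n) ((xi k ^^ m) w)"
proof -
  obtain p s where "(xi k ^^ n) [Plain 0] = p @ w @ s"
    using assms by (auto simp: iterate_factor_def)
  then have "(xi k ^^ (m + n)) [Plain 0] = (xi k ^^ m) p @ (xi k ^^ m) w @ (xi k ^^ m) s"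
    by (simp add: funpow_add xi_power_append)
  then show ?thesis unfolding iterate_factor_def by blast
qed

lemma iterate_factor_x_word:
  assumes "iterate_factor k n w"
  shows "is_factor (map pi_letter w) (x_word k)"
proof -
  obtain p s where ps: "(xi k ^^ n) [Plain 0] = p @ w @ s"
    using assms by (auto simp: iterate_factor_def)
  have "map pi_letter w = x_word k [length p \<rightarrow> length p + length (map pi_letter w)]"
  proof (rule nth_equalityI)
    fix i assume "i < length (map pi_letter w)"
    then have "w ! i = u_word k (length p + i)"
      using xi_iterate_nth[of "length p + i" n k] by (simp add: ps nth_append)
    then show "map pi_letter w ! i
        = x_word k [length p \<rightarrow> length p + length (map pi_letter w)] ! i"
      using \<open>i < length (map pi_letter w)\<close> by (simp add: x_word_def)
  qed simp
  then show ?thesis unfolding is_factor_def by blast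
qed

section \<open>Powers with an explicit base\<close>

lemma replicate_is_rat_power: "is_rat_power (replicate (k + 1) a) [a] (of_nat (k + 1))"
proof -
  have "replicate (k + 1) a = prefix (length (replicate (k + 1) a)) ([a]\<^sup>\<omega>)"
    by (rule nth_equalityI) (simp_all del: replicate_Suc subseq_to_Suc)
  then show ?thesis unfolding is_rat_power_def by simp
qed

lemma square_is_rat_power:
  assumes "w \<noteq> []"
  shows "is_rat_power (w @ w) w 2"
proof -
  have "w @ w = prefix (length (w @ w)) (w\<^sup>\<omega>)"
  proof (rule nth_equalityI)
    fix i assume "i < length (w @ w)"
    then show "(w @ w) ! i = prefix (length (w @ w)) (w\<^sup>\<omega>) ! i"
      using assms by (auto simp: nth_append mod_if)
  qed simp
  moreover have "(2 :: rat) = of_nat (length (w @ w)) / of_nat (length w)"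
    using assms by (simp add: field_simps)
  ultimately show ?thesis using assms unfolding is_rat_power_def by blast
qed

subsection \<open>Desubstitution\<close>

context
  fixes k :: nat
  assumes k: "k \<ge> 4"
begin

lemma last_xi_letter: "last (xi_letter k a) = next_letter k a"
  using k by (cases a rule: lit_cases) (simp add: xi_letter_lit next_letter_lit)

lemma hd_xi_letter_starts: "starts_image (hd (xi_letter k a))"
  using k by (cases a rule: lit_cases) (auto simp: xi_letter_lit)

lemma hd_xi_starts: "w = [] \<or> starts_image (hd (xi k w))"
  by (cases w) (simp_all add: xi_Cons hd_xi_letter_starts xi_letter_nonempty)

text \<open>The only ambiguity when an image is known by its first letter alone; in the arguments
  below a neighbouring letter decides it.\<close>

lemma hd_xi_letter_eq_lit_0:
  assumes "hd (xi_letter k a) = lit c 0"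
  shows "a = lit c 0 \<or> a = lit (\<not> c) (k - 1)"
  using assms by (cases a rule: lit_cases) (auto simp: xi_letter_lit split: if_splits)

lemma hd_xi_letter_eq_lit_Suc:
  assumes "hd (xi_letter k a) = lit c (Suc j)" "j > 0"
  shows "a = lit c j"
  using assms by (cases a rule: lit_cases) (auto simp: xi_letter_lit split: if_splits)

section \<open>Cutting words into images of letters\<close>

lemma xi_neq_lit_1: "xi k w \<noteq> lit b (Suc 0) # r"
  using hd_xi_starts[of w] by (metis One_nat_def list.sel(1) list.distinct(1) starts_image_lit xi_Nil)

text \<open>A cut can fall inside the image of a letter only between \<open>lit s 0\<close> and
  \<open>lit s 1\<close>, and the condition on \<open>hd b\<close> rules this out.\<close>

lemma xi_split:
  assumes "xi k v = a @ b" "b = [] \<or> starts_image (hd b)"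
  shows "\<exists>v1 v2. v = v1 @ v2 \<and> xi k v1 = a \<and> xi k v2 = b"
  using assms
proof (induction v arbitrary: a)
  case Nil
  then show ?case by simp
next
  case (Cons c v)
  show ?case
  proof (cases "a = []")
    case True
    then show ?thesis
      using Cons.prems(1) by (intro exI[of _ "[]"] exI[of _ "c # v"]) simp
  next
    case False
    obtain s j where c: "c = lit s j" by (rule lit_cases)
    obtain a' where a': "a = xi_letter k c @ a'"
    proof (cases "length (xi_letter k c) \<le> length a")
      case True
      then show ?thesis
        using Cons.prems(1) that by (auto simp: xi_Cons append_eq_append_conv2)
    next
      case shorter: False
      moreover have "length a \<ge> 1" using False by (cases a) auto
      ultimately have "j = 0" "length a = 1"
        by (auto simp: c xi_letter_lit split: if_splits)
      then have "b \<noteq> [] \<and> hd b = lit s 1"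
        using Cons.prems(1) by (auto simp: c xi_letter_lit xi_Cons length_Suc_conv)
      then show ?thesis using Cons.prems(2) by simp
    qed
    then have "xi k v = a' @ b"
      using Cons.prems(1) by (simp add: xi_Cons)
    from Cons.IH[OF this Cons.prems(2)] obtain v1 v2
      where "v = v1 @ v2" "xi k v1 = a'" "xi k v2 = b" by blast
    then show ?thesis
      by (intro exI[of _ "c # v1"] exI[of _ v2]) (simp add: a' xi_Cons)
  qed
qed

text \<open>Images of different letters share their first letter only if they are
  \<open>[lit c 0, lit c 1]\<close> and \<open>[lit c 0]\<close>. No image begins with
  \<open>lit c 1\<close>, so the letter after \<open>lit c 0\<close> tells them apart.\<close>

lemma xi_inj: "xi k v = xi k w \<Longrightarrow> v = w"
proof (induction v arbitrary: w)
  case Nil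
  then show ?case by (metis xi_Nil xi_eq_Nil_iff)
next
  case (Cons a v)
  then obtain c w' where w: "w = c # w'"
    by (metis list.exhaust list.distinct(1) xi_Nil xi_eq_Nil_iff)
  obtain s i where a: "a = lit s i" by (rule lit_cases)
  obtain t j where c: "c = lit t j" by (rule lit_cases)
  have eq: "xi_letter k a @ xi k v = xi_letter k c @ xi k w'"
    using Cons.prems by (simp add: w xi_Cons)
  have "a = c" "xi k v = xi k w'"
    using eq k xi_neq_lit_1 xi_neq_lit_1[symmetric] unfolding a c
    by (auto simp: xi_letter_lit split: if_splits)
  then show ?case using Cons.IH w by simp
qed

lemma xi_split_concat:
  assumes "xi k v = p @ concat ws @ t"
    and "t \<noteq> []" "starts_image (hd t)"
    and "\<forall>w \<in> set ws. w = [] \<or> starts_image (hd w)"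
  shows "\<exists>q vs u. v = q @ concat vs @ u \<and> xi k q = p \<and> map (xi k) vs = ws \<and> xi k u = t"
  using assms
proof (induction ws arbitrary: p)
  case Nil
  then obtain q u where "v = q @ u" "xi k q = p" "xi k u = t"
    using xi_split[of v p t] by auto
  then show ?case by (intro exI[of _ q] exI[of _ "[]"] exI[of _ u]) simp
next
  case (Cons w ws)
  have "xi k v = (p @ w) @ concat ws @ t" using Cons.prems(1) by simp
  from Cons.IH[OF this] Cons.prems obtain q vs u where
    v: "v = q @ concat vs @ u" "xi k q = p @ w" "map (xi k) vs = ws" "xi k u = t" by auto
  from xi_split[OF v(2)] Cons.prems(4) obtain q1 q2
    where "q = q1 @ q2" "xi k q1 = p" "xi k q2 = w" by auto
  then show ?case
    using v by (intro exI[of _ q1] exI[of _ "q2 # vs"] exI[of _ u]) simp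
qed

lemma iterate_factor_lit:
  assumes "iterate_factor k n w" "a \<in> set w"
  obtains b j where "a = lit b j" "j < k"
proof -
  obtain p s where w: "(xi k ^^ n) [Plain 0] = p @ w @ s"
    using assms(1) by (auto simp: iterate_factor_def)
  then obtain i where "i < length ((xi k ^^ n) [Plain 0])" "a = ((xi k ^^ n) [Plain 0]) ! i"
    using assms(2) by (metis Un_iff in_set_conv_nth set_append)
  then have "a \<in> alphabet k"
    using u_word_in_alphabet k by (simp add: xi_iterate_nth)
  then show ?thesis
    using that by (metis lit_cases lit_in_alphabet_iff)
qed

lemma iterate_factor_0_length: "iterate_factor k 0 w \<Longrightarrow> length w \<le> 1"
proof -
  assume "iterate_factor k 0 w"
  then obtain p s where "[Plain 0] = p @ w @ s" by (auto simp: iterate_factor_def)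
  then have "length [Plain 0] = length p + length w + length s" by (metis length_append add.assoc)
  then show ?thesis by simp
qed

text \<open>By injectivity both copies of \<open>w\<close> pull back to the same word. The tail
  \<open>t\<close> may end inside an image, so it is only known to begin the image of what follows;
  \<open>r\<close> is the surplus.\<close>

lemma desubstitute:
  assumes "iterate_factor k (Suc n) (w @ xi k m @ w @ t)"
    and "t \<noteq> []" "starts_image (hd t)" "w = [] \<or> starts_image (hd w)"
  obtains v d u r where "xi k v = w" "xi k (d # u) = t @ r"
    "iterate_factor k n (v @ m @ v @ d # u)"
proof -
  obtain p s where "xi k ((xi k ^^ n) [Plain 0]) = p @ concat [w, xi k m, w] @ (t @ s)"
    using assms(1) by (auto simp: iterate_factor_def)
  then have "\<exists>q vs u. (xi k ^^ n) [Plain 0] = q @ concat vs @ u \<and> xi k q = p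
      \<and> map (xi k) vs = [w, xi k m, w] \<and> xi k u = t @ s"
    by (rule xi_split_concat) (use assms(2-4) hd_xi_starts[of m] in auto)
  then obtain q vs u where
    v: "(xi k ^^ n) [Plain 0] = q @ concat vs @ u" "map (xi k) vs = [w, xi k m, w]"
      "xi k u = t @ s"
    by (elim exE conjE) (rule that)
  obtain v m' v' where vs: "vs = [v, m', v']" "xi k v = w" "xi k m' = xi k m" "xi k v' = w"
    using v(2) by (auto simp: map_eq_Cons_conv)
  then have "m' = m" "v' = v" by (simp_all add: xi_inj)
  moreover obtain d u' where "u = d # u'" using v(3) assms(2) by (cases u) auto
  ultimately have "(xi k ^^ n) [Plain 0] = q @ (v @ m @ v @ d # u') @ []"
    "xi k (d # u') = t @ s"
    using v vs by simp_all
  then show ?thesis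
    using that vs(2) unfolding iterate_factor_def by blast
qed

text \<open>The image ending in \<open>y\<close> may begin further left, but the last letter of an
  image alone determines its preimage through \<open>next_letter\<close>.\<close>

lemma desubstitute_after:
  assumes "iterate_factor k (Suc n) (y # xi k m @ t)"
    and "t \<noteq> []" "starts_image (hd t)"
  obtains x d u r where "next_letter k x = y" "xi k (d # u) = t @ r"
    "iterate_factor k n (x # m @ d # u)"
proof -
  obtain p s where "xi k ((xi k ^^ n) [Plain 0]) = (p @ [y]) @ concat [xi k m] @ (t @ s)"
    using assms(1) by (auto simp: iterate_factor_def)
  then have "\<exists>q vs u. (xi k ^^ n) [Plain 0] = q @ concat vs @ u \<and> xi k q = p @ [y]
      \<and> map (xi k) vs = [xi k m] \<and> xi k u = t @ s"
    by (rule xi_split_concat) (use assms(2-3) hd_xi_starts[of m] in auto)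
  then obtain q vs u where
    v: "(xi k ^^ n) [Plain 0] = q @ concat vs @ u" "xi k q = p @ [y]"
      "map (xi k) vs = [xi k m]" "xi k u = t @ s"
    by (elim exE conjE) (rule that)
  have vs: "vs = [m]" using v(3) by (auto simp: map_eq_Cons_conv xi_inj)
  obtain d u' where u: "u = d # u'" using v(4) assms(2) by (cases u) auto
  obtain q' x where q: "q = q' @ [x]" using v(2) by (cases q rule: rev_cases) auto
  have "last (xi k q) = next_letter k x"
    by (simp add: q xi_append xi_Cons xi_letter_nonempty last_xi_letter)
  then have "next_letter k x = y" using v(2) by simp
  moreover have "(xi k ^^ n) [Plain 0] = q' @ (x # m @ d # u') @ []"
    using v(1) q u vs by simp
  then have "iterate_factor k n (x # m @ d # u')"
    unfolding iterate_factor_def by blast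
  ultimately show ?thesis using that v(4) u by blast
qed

section \<open>The letter preceding a given one\<close>

lemma letter_before_lit_1:
  "xi k v = p @ a # lit b (Suc 0) # s \<Longrightarrow> a = lit b 0"
proof (induction v arbitrary: p)
  case Nil
  then show ?case by simp
next
  case (Cons c v)
  obtain t j where c: "c = lit t j" by (rule lit_cases)
  show ?case
  proof (cases "j = 0")
    case True
    then show ?thesis
      using Cons xi_neq_lit_1 by (cases p; cases "tl p") (auto simp: c xi_Cons xi_letter_lit)
  next
    case False
    then show ?thesis
      using Cons xi_neq_lit_1 by (cases p) (auto simp: c xi_Cons xi_letter_lit split: if_splits)
  qed
qed

lemma iterate_factor_Suc:
  assumes "iterate_factor k n w" "length w \<ge> 2"
  obtains n' where "n = Suc n'"
  using assms iterate_factor_0_length by (cases n) fastforce+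

text \<open>Index 1 occurs only inside an image. For \<open>j > 0\<close> the letter
  \<open>lit b (Suc j)\<close> is the image of \<open>lit b j\<close>, which by induction follows
  \<open>lit b (j - 1)\<close>, and the image of the latter ends in \<open>lit b j\<close>.\<close>

lemma letter_before:
  "iterate_factor k n (a # lit b (Suc j) # s) \<Longrightarrow> a = lit b j"
proof (induction n arbitrary: a j s)
  case 0
  then show ?case using iterate_factor_0_length by force
next
  case (Suc n)
  show ?case
  proof (cases "j = 0")
    case True
    then obtain p s' where "xi k ((xi k ^^ n) [Plain 0]) = p @ a # lit b (Suc 0) # s'"
      using Suc.prems by (auto simp: iterate_factor_def)
    then show ?thesis using letter_before_lit_1 True by blast
  next
    case False
    have "iterate_factor k (Suc n) (a # xi k [] @ lit b (Suc j) # s)"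
      using Suc.prems by simp
    then obtain x d u r where d: "next_letter k x = a" "xi k (d # u) = (lit b (Suc j) # s) @ r"
      "iterate_factor k n (x # [] @ d # u)"
      by (rule desubstitute_after) (use False in simp_all)
    have "hd (xi_letter k d) = lit b (Suc j)"
      unfolding hd_xi_Cons[symmetric, of k d u] d(2) by simp
    then have "d = lit b j" by (rule hd_xi_letter_eq_lit_Suc) (use False in simp)
    moreover obtain i where i: "j = Suc i" using False by (cases j) auto
    ultimately have "iterate_factor k n (x # lit b (Suc i) # u)"
      using d(3) by simp
    then have "x = lit b i" by (rule Suc.IH)
    moreover have "Suc j < k"
      by (rule iterate_factor_lit[OF Suc.prems, of "lit b (Suc j)"]) auto
    ultimately show ?thesis
      using d(1) i by (auto simp: next_letter_lit split: if_splits)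
  qed
qed

lemma last_before:
  assumes "iterate_factor k n (p @ w @ lit b j # s)" "w \<noteq> []" "0 < j"
  shows "last w = lit b (j - 1)"
proof -
  have "p @ w @ lit b j # s = (p @ butlast w) @ last w # lit b j # s"
    using assms(2) by simp
  then have "iterate_factor k n (last w # lit b (Suc (j - 1)) # s)"
    using assms(1,3) iterate_factor_right by (metis Suc_pred')
  then show ?thesis by (rule letter_before)
qed

lemma xi_eq_hd: "xi k (d # u) = a # r \<Longrightarrow> hd (xi_letter k d) = a"
  by (metis hd_xi_Cons list.sel(1))

lemma xi_run:
  "Suc j < k \<Longrightarrow> xi k (map (lit c) [0..<Suc j]) = map (lit c) [0..<Suc (Suc j)]"
proof (induction j)
  case 0
  then show ?case by (simp add: xi_Cons xi_letter_lit)
next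
  case (Suc j)
  have "xi k (map (lit c) [0..<Suc (Suc j)])
      = xi k (map (lit c) [0..<Suc j]) @ xi_letter k (lit c (Suc j))"
    by (simp add: xi_append xi_Cons)
  then show ?case using Suc by (simp add: xi_letter_lit)
qed

subsection \<open>Neighbours of blocks and overlap-freeness\<close>

text \<open>
  A letter \<open>lit b 0\<close> not followed by \<open>lit b 1\<close> stems from \<open>lit (\<not> b) (k - 1)\<close>; this is the base
  case, and applying \<open>xi\<close> moves both neighbours of the block along the cycle of letters.
\<close>

lemma block_neighbours:
  assumes "iterate_factor k n (y # map (lit c) [0..<Suc j] @ [d])"
  shows "next_letter k y = lit c j \<or> d = next_letter k (lit c j)"
  using assms
proof (induction j arbitrary: n y d)
  case 0
  show ?case
  proof (cases "d = lit c 1")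
    case True
    then show ?thesis using k by (simp add: next_letter_lit)
  next
    case False
    have "iterate_factor k n (lit c 0 # d # [])"
      using "0.prems" iterate_factor_right[of k n "[y]"] by simp
    then have d: "starts_image d"
      using False letter_before[of n "lit c 0" _ 0] by (auto simp: starts_image_def)
    obtain n' where n: "n = Suc n'"
      using "0.prems" by (rule iterate_factor_Suc) simp
    have "xi k [lit (\<not> c) (k - 1)] = [lit c 0]"
      using k by (simp add: xi_Cons xi_letter_lit)
    then have "iterate_factor k (Suc n') (y # xi k [lit (\<not> c) (k - 1)] @ [d])"
      using "0.prems" n by simp
    then obtain x e u where x: "next_letter k x = y"
      "iterate_factor k n' (x # [lit (\<not> c) (k - 1)] @ e # u)"
      by (rule desubstitute_after) (use d in simp_all)
    \<comment> \<open>The predecessor of \<open>lit (\<not> c) (k - 1)\<close> has index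
      \<open>k - 2\<close>, and its image ends in \<open>lit (\<not> c) (k - 1)\<close>, the letter
      just before \<open>lit c 0\<close> on the cycle.\<close>
    then have "last [x] = lit (\<not> c) (k - 1 - 1)"
      using k by (intro last_before[of n' "[]" "[x]" "\<not> c" "k - 1" "e # u"]) simp_all
    then have "y = lit (\<not> c) (k - 1)"
      using x(1) k by (auto simp: next_letter_lit)
    then show ?thesis by (simp add: next_letter_lit)
  qed
next
  case (Suc j)
  let ?block = "map (lit c) [0..<Suc (Suc j)]"
  have less: "Suc j < k"
    by (rule iterate_factor_lit[OF Suc.prems, of "lit c (Suc j)"]) auto
  have "iterate_factor k n (lit c (Suc j) # d # [])"
    using Suc.prems iterate_factor_right[of k n "y # map (lit c) [0..<Suc j]" "[lit c (Suc j), d]"]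
    by simp
  then have d: "starts_image d"
    using letter_before[of n "lit c (Suc j)" _ 0] by (auto simp: starts_image_def)
  obtain n' where n: "n = Suc n'"
    using Suc.prems by (rule iterate_factor_Suc) simp
  have "iterate_factor k (Suc n') (y # xi k (map (lit c) [0..<Suc j]) @ [d])"
    using Suc.prems n by (simp only: xi_run[OF less])
  then obtain x e u r where x: "next_letter k x = y" "xi k (e # u) = [d] @ r"
    "iterate_factor k n' (x # map (lit c) [0..<Suc j] @ e # u)"
    by (rule desubstitute_after) (use d in simp_all)
  then have "iterate_factor k n' (x # map (lit c) [0..<Suc j] @ [e])"
    using iterate_factor_left[of k n' "x # map (lit c) [0..<Suc j] @ [e]" u] by simp
  from Suc.IH[OF this] show ?case
  proof
    assume "next_letter k x = lit c j"
    moreover have "j \<noteq> k - 1" using less by simp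
    ultimately show ?thesis using x(1) by (simp add: next_letter_lit)
  next
    assume "e = next_letter k (lit c j)"
    then have "e = lit c (Suc j)" using less by (simp add: next_letter_lit)
    moreover have "hd (xi_letter k e) = d"
      using x(2) xi_eq_hd by simp
    ultimately show ?thesis by (auto simp: xi_letter_lit next_letter_lit)
  qed
qed

section \<open>Squares followed by one more letter\<close>

lemma hd_preimage:
  assumes "hd (xi k w) = lit c 0" "w \<noteq> []"
    and "iterate_factor k n (p @ y @ w @ s)" "y \<noteq> []" "last y \<noteq> lit (\<not> c) (k - 2)"
  shows "hd w = lit c 0"
proof (rule ccontr)
  assume "hd w \<noteq> lit c 0"
  moreover obtain a w' where w: "w = a # w'" using assms(2) by (cases w) auto
  ultimately have "a = lit (\<not> c) (k - 1)"
    using assms(1) hd_xi_letter_eq_lit_0[of a c] by (simp add: hd_xi_Cons)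
  \<comment> \<open>The other preimage would have to be preceded by
    \<open>lit (\<not> c) (k - 2)\<close>, which is not the last letter of \<open>y\<close>.\<close>
  then have "last y = lit (\<not> c) (k - 1 - 1)"
    using assms(3,4) k unfolding w
    by (intro last_before[of n p y "\<not> c" "k - 1" "w' @ s"]) simp_all
  then show False using assms(5) k by (simp add: numeral_2_eq_2)
qed

text \<open>Desubstitution keeps this shape and lowers \<open>j\<close>, because the letters of
  index 0 keep their identity by \<open>hd_preimage\<close>. For \<open>j = 0\<close> the copies of
  \<open>v\<close> end in \<open>lit b 0\<close>; the last one, followed by
  \<open>lit (\<not> b) 0\<close>, must stem from \<open>lit (\<not> b) (k - 1)\<close>, and this
  puts impossible neighbours around \<open>lit b 0\<close>.\<close>

lemma no_alternating_extension:
  assumes "iterate_factor k n (v @ [lit b (Suc j)] @ v @ [lit (\<not> b) 0])"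
    and "v \<noteq> []" "hd v = lit b 0"
  shows False
  using assms
proof (induction j arbitrary: n v)
  case 0
  have "last v = lit b (Suc 0 - 1)"
    by (rule last_before[of n "[]" v b "Suc 0" "v @ [lit (\<not> b) 0]"]) (use "0.prems" in simp_all)
  then obtain w where v: "v = w @ [lit b 0]"
    using "0.prems"(2) by (metis append_butlast_last_id diff_Suc_1)
  then have hd_w: "w = [] \<or> hd w = lit b 0" using "0.prems"(3) by (cases w) auto
  obtain n' where n: "n = Suc n'"
    using "0.prems"(1) by (rule iterate_factor_Suc) simp
  have "iterate_factor k (Suc n') (w @ xi k [lit b 0] @ w @ [lit b 0, lit (\<not> b) 0])"
    using "0.prems"(1) by (simp add: v n xi_Cons xi_letter_lit)
  then obtain t d u r where t: "xi k t = w" "xi k (d # u) = [lit b 0, lit (\<not> b) 0] @ r"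
      "iterate_factor k n' (t @ [lit b 0] @ t @ d # u)"
    by (rule desubstitute) (use hd_w in auto)
  have "hd (xi_letter k d) = lit b 0"
    by (rule xi_eq_hd[of d u _ "lit (\<not> b) 0 # r"]) (simp add: t(2))
  moreover have "d \<noteq> lit b 0"
    using t(2) by (auto simp: xi_Cons xi_letter_lit)
  ultimately have d: "d = lit (\<not> b) (k - 1)"
    using hd_xi_letter_eq_lit_0 by blast
  have last_t: "last ([lit b 0] @ t) = lit (\<not> b) (k - 1 - 1)"
    by (rule last_before[of n' t _ _ _ u]) (use t(3) d k in simp_all)
  then have "t \<noteq> []" by auto
  have "hd t = lit b 0"
    by (rule hd_preimage[of _ _ n' t "[lit b 0]" "d # u"])
      (use t \<open>t \<noteq> []\<close> hd_w k in auto)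
  then obtain t' where t_Cons: "t = lit b 0 # t'" using \<open>t \<noteq> []\<close> by (cases t) auto
  \<comment> \<open>The middle letter \<open>lit b 0\<close> is preceded by
    \<open>lit (\<not> b) (k - 2)\<close> and followed by \<open>lit b 0\<close>, against
    \<open>block_neighbours\<close>.\<close>
  have eq: "t @ [lit b 0] @ t @ d # u = butlast t @ [last t, lit b 0, lit b 0] @ t' @ d # u"
    using t_Cons by simp
  have "iterate_factor k n' (butlast t @ [last t, lit b 0, lit b 0] @ t' @ d # u)"
    using t(3) unfolding eq .
  from iterate_factor_middle[OF this]
  have "iterate_factor k n' (last t # map (lit b) [0..<Suc 0] @ [lit b 0])"
    by simp
  from block_neighbours[OF this] show False
    using last_t \<open>t \<noteq> []\<close> k by (auto simp: next_letter_lit split: if_splits)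
next
  case (Suc j)
  have less: "Suc (Suc j) < k"
    by (rule iterate_factor_lit[OF Suc.prems(1), of "lit b (Suc (Suc j))"]) auto
  obtain n' where n: "n = Suc n'"
    using Suc.prems(1) by (rule iterate_factor_Suc) simp
  have "Suc j \<noteq> k - 1" using less by simp
  then have "iterate_factor k (Suc n') (v @ xi k [lit b (Suc j)] @ v @ [lit (\<not> b) 0])"
    using Suc.prems(1) by (simp add: n xi_Cons xi_letter_lit)
  then obtain t d u r where t: "xi k t = v" "xi k (d # u) = [lit (\<not> b) 0] @ r"
      "iterate_factor k n' (t @ [lit b (Suc j)] @ t @ d # u)"
    by (rule desubstitute) (use Suc.prems(3) in auto)
  have "t \<noteq> []" using t(1) Suc.prems(2) by auto
  have last_t: "last t = lit b (Suc j - 1)"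
    by (rule last_before[of n' "[]" t _ _ "t @ d # u"]) (use t(3) \<open>t \<noteq> []\<close> in simp_all)
  have hd_d: "hd (xi k (d # u)) = lit (\<not> b) 0" using t(2) by simp
  have "hd (d # u) = lit (\<not> b) 0"
    by (rule hd_preimage[of _ _ n' "t @ [lit b (Suc j)]" t "[]"])
      (use t(3) hd_d \<open>t \<noteq> []\<close> last_t less in auto)
  moreover have "hd t = lit b 0"
    by (rule hd_preimage[of _ _ n' t "[lit b (Suc j)]" "d # u"])
      (use t Suc.prems(3) \<open>t \<noteq> []\<close> in auto)
  moreover have "iterate_factor k n' (t @ [lit b (Suc j)] @ t @ [d])"
    using t(3) iterate_factor_left[of k n' _ u] by simp
  ultimately show False
    using Suc.IH[of n' t] \<open>t \<noteq> []\<close> by simp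
qed

text \<open>Desubstitution lowers the index of the final letter. Once this index is 1, a further
  step leads to the shape excluded by \<open>no_alternating_extension\<close>, with middle index
  \<open>k - 1\<close>.\<close>

lemma no_square_extension:
  assumes "iterate_factor k n (w @ w @ [lit b (Suc j)])"
    and "w \<noteq> []" "hd w = lit (\<not> b) 0"
  shows False
  using assms
proof (induction j arbitrary: n w)
  case 0
  have "last w = lit b (Suc 0 - 1)"
    by (rule last_before[of n w w b "Suc 0" "[]"]) (use "0.prems" in simp_all)
  then obtain v where w: "w = v @ [lit b 0]"
    using "0.prems"(2) by (metis append_butlast_last_id diff_Suc_1)
  then have v: "v \<noteq> []" "hd v = lit (\<not> b) 0" using "0.prems"(3) by (cases v; auto)+
  obtain n' where n: "n = Suc n'"
    using "0.prems"(1) by (rule iterate_factor_Suc) (simp add: w)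
  \<comment> \<open>The two occurrences of \<open>lit b 0\<close> have different preimages: the
    first is a complete image, as \<open>v\<close> begins with \<open>lit (\<not> b) 0\<close>,
    while the second is followed by \<open>lit b 1\<close>.\<close>
  have "iterate_factor k (Suc n') (v @ xi k [lit (\<not> b) (k - 1)] @ v @ [lit b 0, lit b 1])"
    using "0.prems"(1) k by (simp add: w n xi_Cons xi_letter_lit)
  then obtain t d u r where t: "xi k t = v" "xi k (d # u) = [lit b 0, lit b 1] @ r"
      "iterate_factor k n' (t @ [lit (\<not> b) (k - 1)] @ t @ d # u)"
    by (rule desubstitute) (use v in auto)
  have "d \<noteq> lit (\<not> b) (k - 1)"
    using t(2) xi_neq_lit_1 k by (auto simp: xi_Cons xi_letter_lit)
  moreover have "hd (xi_letter k d) = lit b 0"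
    by (rule xi_eq_hd[of d u _ "lit b 1 # r"]) (simp add: t(2))
  ultimately have d: "d = lit b 0" using hd_xi_letter_eq_lit_0 by blast
  have "t \<noteq> []" using t(1) v(1) by auto
  have "hd t = lit (\<not> b) 0"
    by (rule hd_preimage[of _ _ n' t "[lit (\<not> b) (k - 1)]" "d # u"])
      (use t v \<open>t \<noteq> []\<close> k in auto)
  moreover have "iterate_factor k n' (t @ [lit (\<not> b) (Suc (k - 2))] @ t @ [d])"
    using t(3) iterate_factor_left[of k n' _ u] k by (simp add: numeral_2_eq_2 Suc_diff_Suc)
  ultimately show False
    using no_alternating_extension[of n' t "\<not> b" "k - 2"] d \<open>t \<noteq> []\<close> by simp
next
  case (Suc j)
  have less: "Suc (Suc j) < k"
    by (rule iterate_factor_lit[OF Suc.prems(1), of "lit b (Suc (Suc j))"]) auto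
  obtain n' where n: "n = Suc n'"
    using Suc.prems(1) by (rule iterate_factor_Suc) (use Suc.prems(2) in \<open>cases w; simp\<close>)
  have "iterate_factor k (Suc n') (w @ xi k [] @ w @ [lit b (Suc (Suc j))])"
    using Suc.prems(1) by (simp add: n)
  then obtain t d u r where t: "xi k t = w" "xi k (d # u) = [lit b (Suc (Suc j))] @ r"
      "iterate_factor k n' (t @ [] @ t @ d # u)"
    by (rule desubstitute) (use Suc.prems(3) in auto)
  have "t \<noteq> []" using t(1) Suc.prems(2) by auto
  have "hd (xi_letter k d) = lit b (Suc (Suc j))"
    by (rule xi_eq_hd[of d u _ r]) (simp add: t(2))
  then have d: "d = lit b (Suc j)" by (rule hd_xi_letter_eq_lit_Suc) simp
  have last_t: "last t = lit b (Suc j - 1)"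
    by (rule last_before[of n' t t _ _ u]) (use t(3) d \<open>t \<noteq> []\<close> in simp_all)
  have "hd t = lit (\<not> b) 0"
    by (rule hd_preimage[of _ _ n' "[]" t "d # u"])
      (use t Suc.prems(3) \<open>t \<noteq> []\<close> last_t less in auto)
  moreover have "iterate_factor k n' (t @ t @ [d])"
    using t(3) iterate_factor_left[of k n' _ u] by simp
  ultimately show False
    using Suc.IH[of n' t] d \<open>t \<noteq> []\<close> by simp
qed

section \<open>Overlaps in the iterates\<close>

lemma extend_left:
  assumes "iterate_factor k n (lit b (Suc j) # w)"
  shows "iterate_factor k n (lit b j # lit b (Suc j) # w)"
proof -
  obtain p s where ps: "(xi k ^^ n) [Plain 0] = p @ lit b (Suc j) # w @ s"
    using assms by (auto simp: iterate_factor_def)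
  \<comment> \<open>The iterate begins with index 0, so a letter of positive index has a left
    neighbour.\<close>
  obtain r where "(xi k ^^ n) [Plain 0] = lit False 0 # r"
    using xi_iterate_head by (metis Plain_eq_lit)
  then obtain p' a where p: "p = p' @ [a]" using ps by (cases p rule: rev_cases) auto
  then have f: "iterate_factor k n (a # lit b (Suc j) # w)"
    using ps by (auto simp: iterate_factor_def)
  then have "a = lit b j" by (rule letter_before)
  then show ?thesis using f by simp
qed

text \<open>Both copies of \<open>w\<close> are preceded by \<open>lit b j\<close>, the second
  because \<open>w\<close> ends in it. Shifting the square one place to the left therefore gives an
  overlap.\<close>

lemma rotate_square:
  assumes "iterate_factor k n (w @ w)" "w \<noteq> []" "hd w = lit b (Suc j)"
  obtains v where "iterate_factor k n (v @ v @ [hd v])" "v \<noteq> []" "hd v = lit b j"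
proof -
  obtain w' where w: "w = lit b (Suc j) # w'" using assms(2,3) by (cases w) auto
  have "last w = lit b (Suc j - 1)"
    by (rule last_before[of n "[]" w _ _ w']) (use assms(1) w in simp_all)
  then have w_snoc: "w = butlast w @ [lit b j]"
    using assms(2) by (metis append_butlast_last_id diff_Suc_1)
  have "iterate_factor k n (lit b j # w @ w)"
    using extend_left[of n b j "w' @ w"] assms(1) w by simp
  moreover have "lit b j # w @ w = (lit b j # butlast w) @ (lit b j # butlast w) @ [lit b j]"
    by (subst (1 2) w_snoc) simp
  ultimately show ?thesis
    using that[of "lit b j # butlast w"] by simp
qed

lemma overlap_free:
  "iterate_factor k n (w @ w @ [hd w]) \<Longrightarrow> w \<noteq> [] \<Longrightarrow> False"
proof (induction n arbitrary: w)
  case 0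
  show ?case by (rule iterate_factor_Suc[OF "0.prems"(1)]) (use "0.prems"(2) in \<open>cases w; simp\<close>, simp)
next
  case (Suc n)
  \<comment> \<open>To cut before each copy, the period must begin with a letter that starts an
    image; if it has index 1, the square is shifted left.\<close>
  obtain v where v: "iterate_factor k (Suc n) (v @ v @ [hd v])" "v \<noteq> []" "starts_image (hd v)"
  proof (cases "starts_image (hd w)")
    case True
    then show ?thesis using Suc.prems that by blast
  next
    case False
    then obtain b where hd_w: "hd w = lit b (Suc 0)" by (auto simp: starts_image_def)
    have "iterate_factor k (Suc n) (w @ w)"
      using Suc.prems(1) iterate_factor_left[of k _ "w @ w"] by simp
    then obtain v where "iterate_factor k (Suc n) (v @ v @ [hd v])" "v \<noteq> []" "hd v = lit b 0"
      using Suc.prems(2) hd_w by (rule rotate_square)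
    then show ?thesis using that[of v] by simp
  qed
  have "iterate_factor k (Suc n) (v @ xi k [] @ v @ [hd v])" using v(1) by simp
  then obtain t d u r where t: "xi k t = v" "xi k (d # u) = [hd v] @ r"
      "iterate_factor k n (t @ [] @ t @ d # u)"
    by (rule desubstitute) (use v(3) in auto)
  have "t \<noteq> []" using t(1) v(2) by auto
  then obtain a t' where t_Cons: "t = a # t'" by (cases t) auto
  have f: "iterate_factor k n (t @ t @ [d])"
    using t(3) iterate_factor_left[of k n _ u] by simp
  have "hd (xi_letter k d) = hd v"
    by (rule xi_eq_hd[of d u _ r]) (simp add: t(2))
  also have "\<dots> = hd (xi_letter k a)"
    using t(1) by (auto simp: t_Cons hd_xi_Cons)
  \<comment> \<open>Letters whose images begin alike are equal or form a pair
    \<open>lit c 0\<close>, \<open>lit (\<not> c) (k - 1)\<close>.\<close>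
  finally consider "a = d"
    | b where "a = lit (\<not> b) 0" "d = lit b (k - 1)"
    | b where "a = lit b (k - 1)"
    by (cases a rule: lit_cases; cases d rule: lit_cases)
      (auto simp: xi_letter_lit split: if_splits)
  then show False
  proof cases
    case 1
    then show False using Suc.IH[of t] f t_Cons by simp
  next
    case (2 b)
    then show False
      using no_square_extension[of n t b "k - 2"] f t_Cons k
      by (simp add: numeral_2_eq_2 Suc_diff_Suc)
  next
    \<comment> \<open>Here the square alone suffices, since shifting it left produces an overlap
      whatever \<open>d\<close> is.\<close>
    case (3 b)
    have "iterate_factor k n (t @ t)"
      using f iterate_factor_left[of k _ "t @ t"] by simp
    moreover note \<open>t \<noteq> []\<close>
    moreover have "hd t = lit b (Suc (k - 2))"
      using 3 t_Cons k by (simp add: numeral_2_eq_2 Suc_diff_Suc)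
    ultimately obtain v where "iterate_factor k n (v @ v @ [hd v])" "v \<noteq> []"
      by (rule rotate_square)
    then show False by (rule Suc.IH)
  qed
qed

subsection \<open>Repetitions in the binary word\<close>

lemma u_word_factor:
  obtains n where "iterate_factor k n (map (u_word k) [i..<i + l])"
proof -
  let ?N = "length ((xi k ^^ (i + l)) [Plain 0])"
  have less: "i + l < ?N" by (rule length_xi_iterate)
  have "(xi k ^^ (i + l)) [Plain 0] = map (u_word k) [0..<?N]"
    using xi_iterate_prefix_u_word[of "i + l" k] by (simp add: subsequence_def)
  also have "[0..<?N] = [0..<i] @ [i..<i + l] @ [i + l..<?N]"
    using less upt_add_eq_append[of 0 i l] upt_add_eq_append[of 0 "i + l" "?N - (i + l)"]
    by simp
  finally show ?thesis
    using that unfolding iterate_factor_def map_append by blast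
qed

lemma u_word_lit: obtains b j where "u_word k i = lit b j" "j < k"
proof -
  have "u_word k i \<in> alphabet k" using u_word_in_alphabet k by simp
  then show ?thesis
    using that by (cases "u_word k i" rule: lit_cases) (simp add: lit_in_alphabet_iff)
qed

lemma u_word_0: "u_word k 0 = lit False 0"
  by (simp add: u_word_def Plain_eq_lit)

lemma u_word_before:
  assumes "u_word k (Suc i) = lit b (Suc j)"
  shows "u_word k i = lit b j"
proof -
  obtain n where "iterate_factor k n (map (u_word k) [i..<i + 2])" by (rule u_word_factor)
  then have "iterate_factor k n (u_word k i # lit b (Suc j) # [])"
    using assms by (simp add: numeral_2_eq_2)
  then show ?thesis by (rule letter_before)
qed

lemma u_word_block:
  assumes "u_word k i = lit b j" "t \<le> j"
  shows "t \<le> i \<and> u_word k (i - t) = lit b (j - t)"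
  using assms(2)
proof (induction t)
  case 0
  then show ?case using assms(1) by simp
next
  case (Suc t)
  then have "t \<le> i" "u_word k (i - t) = lit b (Suc (j - Suc t))" by simp_all
  moreover from this have "i \<noteq> t" using u_word_0 by auto
  ultimately show ?case
    using u_word_before[of "i - Suc t" b "j - Suc t"] by (simp add: Suc_diff_Suc)
qed

lemma u_word_block_neighbours:
  assumes "u_word k (Suc i + j) = lit c j"
  shows "next_letter k (u_word k i) = lit c j \<or> u_word k (Suc (Suc i + j)) = next_letter k (lit c j)"
proof -
  have block: "u_word k (Suc i + t) = lit c t" if "t \<le> j" for t
    using u_word_block[OF assms, of "j - t"] that by simp
  obtain n where n: "iterate_factor k n (map (u_word k) [i..<i + (j + 3)])" by (rule u_word_factor)
  have "map (u_word k) [i..<i + (j + 3)]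
      = u_word k i # map (lit c) [0..<Suc j] @ [u_word k (Suc (Suc i + j))]"
  proof (rule nth_equalityI)
    fix m assume "m < length (map (u_word k) [i..<i + (j + 3)])"
    then consider "m = 0" | t where "m = Suc t" "t \<le> j" | "m = Suc (Suc j)"
      by (cases m) fastforce+
    then show "map (u_word k) [i..<i + (j + 3)] ! m
        = (u_word k i # map (lit c) [0..<Suc j] @ [u_word k (Suc (Suc i + j))]) ! m"
      using block by cases (auto simp: nth_append simp del: upt_Suc)
  qed simp
  then have "iterate_factor k n (u_word k i # map (lit c) [0..<Suc j] @ [u_word k (Suc (Suc i + j))])"
    using n by (simp only:)
  then show ?thesis by (rule block_neighbours)
qed

lemma square_in_u_word:
  assumes "\<forall>i \<in> {q..<q + n}. u_word k i = u_word k (i + n)" "1 \<le> n"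
  obtains m w where "iterate_factor k m (w @ w @ [u_word k (q + 2 * n)])" "w \<noteq> []"
    "hd w = u_word k q"
proof -
  obtain m where m: "iterate_factor k m (map (u_word k) [q..<q + (2 * n + 1)])"
    by (rule u_word_factor)
  let ?w = "map (u_word k) [q..<q + n]"
  have "map (u_word k) [q..<q + (2 * n + 1)] = ?w @ ?w @ [u_word k (q + 2 * n)]"
  proof (rule nth_equalityI)
    fix i assume "i < length (map (u_word k) [q..<q + (2 * n + 1)])"
    then have "i < n \<or> (i = (i - n) + n \<and> i - n < n) \<or> i = 2 * n" by auto
    then consider "i < n" | t where "i = t + n" "t < n" | "i = 2 * n" by blast
    then show "map (u_word k) [q..<q + (2 * n + 1)] ! i = (?w @ ?w @ [u_word k (q + 2 * n)]) ! i"
      using assms(1) by cases (auto simp: nth_append add.assoc)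
  qed simp
  then show ?thesis
    using that[of m ?w] m assms(2) by (simp add: hd_map)
qed

lemma u_word_overlap_free:
  assumes "\<forall>i \<in> {p..p + n}. u_word k i = u_word k (i + n)" "1 \<le> n"
  shows False
proof -
  obtain m w where "iterate_factor k m (w @ w @ [u_word k (p + 2 * n)])" "w \<noteq> []"
    "hd w = u_word k p"
    by (rule square_in_u_word[of p n]) (use assms in auto)
  moreover have "u_word k p = u_word k (p + n)" "u_word k (p + n) = u_word k (p + n + n)"
    using assms(1) by simp_all
  then have "u_word k (p + 2 * n) = u_word k p" by (simp add: mult_2 add.assoc)
  ultimately show False using overlap_free by metis
qed

lemma u_word_no_square_extension:
  assumes "\<forall>i \<in> {q..<q + n}. u_word k i = u_word k (i + n)" "1 \<le> n"
    and "u_word k q = lit (\<not> b) 0" "u_word k (q + 2 * n) = lit b j" "0 < j"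
  shows False
proof -
  obtain m w where w: "iterate_factor k m (w @ w @ [u_word k (q + 2 * n)])" "w \<noteq> []"
    "hd w = u_word k q"
    by (rule square_in_u_word[of q n]) (use assms in auto)
  obtain i where "j = Suc i" using assms(5) by (cases j) auto
  then show False
    using no_square_extension[of m w b i] w assms by simp
qed

section \<open>Recovering letters of \<open>u_word\<close> from their images\<close>

text \<open>
  A nonzero index \<open>i\<close> of a letter determines the \<open>i\<close> letters to its left; comparing the images
  under \<open>pi_letter\<close> there leaves the following as the only ambiguity.
\<close>

lemma pi_ambiguity_aux:
  assumes "u_word k s = lit b j" "u_word k t = lit c i" "i < j" "j < k"
    and "\<forall>r \<le> k - 2. pi_letter (u_word k (s - r)) = pi_letter (u_word k (t - r))"
  shows "i = 0 \<and> c = (\<not> b)"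
proof -
  \<comment> \<open>Going \<open>i\<close> places left brings the second letter to index 0 and
    leaves the first at a positive index. As \<open>i < j < k\<close>, this stays within the
    \<open>k - 2\<close> comparisons.\<close>
  have "u_word k (s - i) = lit b (j - i)" "u_word k (t - i) = lit c 0"
    using u_word_block[OF assms(1), of i] u_word_block[OF assms(2), of i] assms(3) by simp_all
  moreover have "pi_letter (u_word k (s - i)) = pi_letter (u_word k (t - i))"
    using assms(3-5) by simp
  ultimately have "c = (\<not> b)"
    using assms(3) by (simp add: pi_letter_eq_iff)
  moreover have "pi_letter (u_word k s) = pi_letter (u_word k t)"
    using assms(5)[rule_format, of 0] by simp
  then have "i = 0"
    using assms(1-3) \<open>c = (\<not> b)\<close> by (auto simp: pi_letter_eq_iff)
  ultimately show ?thesis by simp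
qed

lemma pi_ambiguity:
  assumes "u_word k s \<noteq> u_word k t"
    and "\<forall>r \<le> k - 2. pi_letter (u_word k (s - r)) = pi_letter (u_word k (t - r))"
  obtains b j where "0 < j" "j < k" "u_word k s = lit b j" "u_word k t = lit (\<not> b) 0"
  | b j where "0 < j" "j < k" "u_word k t = lit b j" "u_word k s = lit (\<not> b) 0"
proof -
  obtain b j where s: "u_word k s = lit b j" "j < k" by (rule u_word_lit)
  obtain c i where t: "u_word k t = lit c i" "i < k" by (rule u_word_lit)
  have "pi_letter (u_word k s) = pi_letter (u_word k t)"
    using assms(2)[rule_format, of 0] by simp
  then have "i \<noteq> j"
    using assms(1) s t by (auto simp: pi_letter_eq_iff split: if_splits)
  then consider "i < j" | "j < i" by linarith
  then show ?thesis
  proof cases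
    case 1
    then show ?thesis
      using pi_ambiguity_aux[OF s(1) t(1) _ s(2) assms(2)] that(1)[of j b] s t by simp
  next
    case 2
    have "\<forall>r \<le> k - 2. pi_letter (u_word k (t - r)) = pi_letter (u_word k (s - r))"
      using assms(2) by simp
    with 2 show ?thesis
      using pi_ambiguity_aux[OF t(1) s(1) _ t(2)] that(2)[of i c] s t by simp
  qed
qed

text \<open>The left neighbour forces \<open>lit (\<not> b) 0\<close> to be followed by
  \<open>lit (\<not> b) 1\<close>. A letter of positive index after \<open>lit b j\<close> would
  keep the prime \<open>b\<close> and have the other image.\<close>

lemma right_of_ambiguity:
  assumes "u_word k s = lit b j" "0 < j" "u_word k (Suc t) = lit (\<not> b) 0"
    and "next_letter k (u_word k t) \<noteq> lit (\<not> b) 0"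
    and "pi_letter (u_word k (s + 1)) = pi_letter (u_word k (Suc t + 1))"
  shows "u_word k (s + 1) = lit b 0" "u_word k (Suc t + 1) = lit (\<not> b) 1"
proof -
  show t: "u_word k (Suc t + 1) = lit (\<not> b) 1"
    using u_word_block_neighbours[of t 0 "\<not> b"] assms(3,4) k by (simp add: next_letter_lit)
  obtain c i where s: "u_word k (Suc s) = lit c i" by (rule u_word_lit)
  have "i = 0"
  proof (rule ccontr)
    assume "i \<noteq> 0"
    then obtain i' where "i = Suc i'" by (cases i) auto
    then have "c = b" using u_word_before[of s c i'] s assms(1) by simp
    then show False using assms(5) s t \<open>i \<noteq> 0\<close> by (simp add: pi_letter_eq_iff)
  qed
  then show "u_word k (s + 1) = lit b 0"
    using assms(5) s t by (simp add: pi_letter_eq_iff)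
qed

text \<open>One place further, both blocks must go on, to \<open>lit b 1\<close> and
  \<open>lit (\<not> b) 2\<close>, whose images differ.\<close>

lemma right_of_ambiguity_contradiction:
  assumes "u_word k s = lit b j" "0 < j" "u_word k (Suc t) = lit (\<not> b) 0"
    and "next_letter k (u_word k t) \<noteq> lit (\<not> b) 0" "next_letter k (u_word k t) \<noteq> lit (\<not> b) 1"
    and "pi_letter (u_word k (s + 1)) = pi_letter (u_word k (Suc t + 1))"
    and "pi_letter (u_word k (s + 2)) = pi_letter (u_word k (Suc t + 2))"
  shows False
proof -
  note next_letters = right_of_ambiguity[OF assms(1-4,6)]
  have "u_word k (Suc (Suc s + 0)) = next_letter k (lit b 0)"
    using u_word_block_neighbours[of s 0 b] next_letters(1) assms(1,2)
    by (auto simp: next_letter_lit split: if_splits)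
  moreover have "u_word k (Suc (Suc t + 1)) = next_letter k (lit (\<not> b) 1)"
    using u_word_block_neighbours[of t 1 "\<not> b"] next_letters(2) assms(5) by simp
  moreover have "0 \<noteq> k - 1" "1 \<noteq> k - 1" using k by simp_all
  ultimately show False
    using assms(7) by (simp add: next_letter_lit pi_letter_eq_iff)
qed

lemma pi_window_determines_aux:
  assumes "u_word k s = lit b j" "0 < j" "j < k" "u_word k t = lit (\<not> b) 0" "k - 1 \<le> t"
    and left: "\<forall>r \<le> k - 1. pi_letter (u_word k (s - r)) = pi_letter (u_word k (t - r))"
    and right: "pi_letter (u_word k (s + 1)) = pi_letter (u_word k (t + 1))"
      "pi_letter (u_word k (s + 2)) = pi_letter (u_word k (t + 2))"
  shows False
proof -
  obtain t' where t': "t = Suc t'" using assms(5) k by (cases t) auto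
  have s': "u_word k (s - 1) = lit b (j - 1)"
    using u_word_block[OF assms(1), of 1] assms(2) by simp
  obtain c i where ci: "u_word k t' = lit c i" "i < k" by (rule u_word_lit)
  have "pi_letter (u_word k (s - 1)) = pi_letter (u_word k (t - 1))"
    using left k by simp
  then have pi_eq: "pi_letter (lit b (j - 1)) = pi_letter (lit c i)"
    using s' ci t' by simp
  \<comment> \<open>The possible left neighbours \<open>lit c i\<close> of
    \<open>lit (\<not> b) 0\<close> with the same image as \<open>lit b (j - 1)\<close>.\<close>
  consider (left_equal) "c = b" "i = j - 1"
    | (block) "j = 1" "c = (\<not> b)" "i \<noteq> 0"
    | (zero) "j \<noteq> 1" "c = (\<not> b)" "i = 0"
    | (different) "j \<noteq> 1" "c = b" "i \<noteq> 0" "i \<noteq> j - 1"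
    using pi_eq assms(2) unfolding pi_letter_eq_iff
    by (cases "c = b"; cases "i = 0"; cases "j = 1"; cases "i = j - 1") auto
  then show False
  proof cases
    case left_equal
    then have "next_letter k (u_word k t') = lit b j"
      using assms(2,3) ci by (simp add: next_letter_lit)
    then show False
      using right_of_ambiguity_contradiction[of s b j t'] assms t' by simp
  next
    case block
    then have "next_letter k (u_word k t') \<in> {lit b 0, lit (\<not> b) (i + 1)}"
      using ci by (simp add: next_letter_lit)
    then have "next_letter k (u_word k t') \<noteq> lit (\<not> b) 0" "next_letter k (u_word k t') \<noteq> lit (\<not> b) 1"
      using block(3) by auto
    then show False
      using right_of_ambiguity_contradiction[of s b j t'] assms t' by simp
  next
    \<comment> \<open>Two letters \<open>lit (\<not> b) 0\<close> in a row are preceded by a block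
      ending in \<open>lit b (k - 1)\<close>. At distance \<open>j\<close> to the left it still has
      a positive index, while the block of \<open>lit b j\<close> has reached index 0.\<close>
    case zero
    obtain t'' where t'': "t' = Suc t''" using assms(5) k t' by (cases t') auto
    have "next_letter k (u_word k t'') = lit (\<not> b) 0"
      using u_word_block_neighbours[of t'' 0 "\<not> b"] ci zero assms(4) t' t'' k
      by (auto simp: next_letter_lit)
    then have "u_word k t'' = lit b (k - 1)"
      by (cases "u_word k t''" rule: lit_cases) (auto simp: next_letter_lit split: if_splits)
    from u_word_block[OF this, of "j - 2"]
    have "u_word k (t'' - (j - 2)) = lit b (k - 1 - (j - 2))"
      using assms(3) by simp
    moreover have "t'' - (j - 2) = t - j" using t' t'' zero assms(2) by simp
    moreover have "u_word k (s - j) = lit b 0" using u_word_block[OF assms(1), of j] by simp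
    moreover have "pi_letter (u_word k (s - j)) = pi_letter (u_word k (t - j))"
      using left assms(3) by simp
    moreover have "k - 1 - (j - 2) \<noteq> 0" using assms(3) k by simp
    ultimately show False by (auto simp: pi_letter_eq_iff)
  next
    \<comment> \<open>Both left neighbours have prime \<open>b\<close> and positive index, so they
      are not an ambiguous pair.\<close>
    case different
    have "u_word k (s - 1) \<noteq> u_word k (t - 1)"
      using s' ci t' different by auto
    moreover have "\<forall>r \<le> k - 2. pi_letter (u_word k (s - 1 - r)) = pi_letter (u_word k (t - 1 - r))"
      using left k by simp
    ultimately show False
      by (rule pi_ambiguity) (use s' ci t' different assms(2) in auto)
  qed
qed

lemma pi_window_determines:
  assumes "k - 1 \<le> s" "k - 1 \<le> t"
    and "\<forall>r \<le> k - 1. pi_letter (u_word k (s - r)) = pi_letter (u_word k (t - r))"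
    and "pi_letter (u_word k (s + 1)) = pi_letter (u_word k (t + 1))"
      "pi_letter (u_word k (s + 2)) = pi_letter (u_word k (t + 2))"
  shows "u_word k s = u_word k t"
proof (rule ccontr)
  assume "u_word k s \<noteq> u_word k t"
  moreover have "\<forall>r \<le> k - 2. pi_letter (u_word k (s - r)) = pi_letter (u_word k (t - r))"
    using assms(3) by simp
  ultimately show False
  proof (rule pi_ambiguity)
    fix b j assume "0 < j" "j < k" "u_word k s = lit b j" "u_word k t = lit (\<not> b) 0"
    then show False using pi_window_determines_aux[of s b j t] assms by blast
  next
    fix b j assume "0 < j" "j < k" "u_word k t = lit b j" "u_word k s = lit (\<not> b) 0"
    then show False using pi_window_determines_aux[of t b j s] assms by simp
  qed
qed

section \<open>Excluding long repetitions of images\<close>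

lemma no_long_run:
  assumes "\<forall>i \<le> k. pi_letter (u_word k (p + i)) = pi_letter (u_word k (p + i + 1))"
  shows False
proof -
  define a where "a = pi_letter (u_word k p)"
  have const: "pi_letter (u_word k (p + i)) = a" if "i \<le> k + 1" for i
    using that
  proof (induction i)
    case (Suc i)
    then show ?case using assms[rule_format, of i] by simp
  qed (simp add: a_def)
  obtain b j where b: "u_word k (p + (k - 1)) = lit b j" "j < k" by (rule u_word_lit)
  then have "u_word k (p + (k - 1 - j)) = lit b 0"
    using u_word_block[OF b(1), of j] by simp
  then have "pi_letter (lit b 0) = pi_letter (lit b j)"
    using const[of "k - 1"] const[of "k - 1 - j"] b(1) by simp
  \<comment> \<open>A positive index would put both images into the run, since the block back to
    \<open>lit b 0\<close> has length at most \<open>k\<close>.\<close>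
  then have b0: "u_word k (p + (k - 1)) = lit b 0"
    using b(1) unfolding pi_letter_eq_iff by (cases "j = 0") auto
  have step: "u_word k (Suc m) = lit b 0"
    if "u_word k m = lit b 0" "pi_letter (u_word k m) = pi_letter (u_word k (Suc m))" for m
  proof -
    obtain c i where c: "u_word k (Suc m) = lit c i" by (rule u_word_lit)
    show ?thesis
    proof (cases i)
      case 0
      then show ?thesis using that c by (simp add: pi_letter_eq_iff)
    next
      case (Suc i')
      then have "c = b" "i' = 0" using u_word_before[of m c i'] c that(1) by simp_all
      then show ?thesis using that c Suc by (simp add: pi_letter_eq_iff)
    qed
  qed
  have b1: "u_word k (Suc (p + (k - 1))) = lit b 0"
    by (rule step[OF b0]) (use const[of "k - 1"] const[of k] k in simp)
  \<comment> \<open>Three consecutive letters \<open>lit b 0\<close> contradict the neighbour rule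
    for the middle one.\<close>
  have "u_word k (Suc (Suc (p + (k - 1)))) = lit b 0"
    by (rule step[OF b1]) (use const[of k] const[of "k + 1"] k in simp)
  then show False
    using u_word_block_neighbours[of "p + (k - 1)" 0 b] b0 b1 k
    by (auto simp: next_letter_lit split: if_splits)
qed

lemma no_long_pi_repetition:
  assumes "1 \<le> n"
    and "\<forall>i < n + k. pi_letter (u_word k (p + i)) = pi_letter (u_word k (p + i + n))"
  shows False
proof (cases "n = 1")
  case True
  then show False using assms(2) by (intro no_long_run[of p]) simp
next
  case False
  \<comment> \<open>The first position with \<open>k - 1\<close> known comparisons to its left.
    Comparisons reach up to \<open>q + n\<close>, so the two needed on the right exist up to
    \<open>q + n - 2\<close>.\<close>
  define q where "q = p + (k - 1)"
  have pi_eq: "pi_letter (u_word k i) = pi_letter (u_word k (i + n))" if "p \<le> i" "i \<le> q + n" for i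
    using assms(2)[rule_format, of "i - p"] that k by (simp add: q_def)
  have pi_left: "pi_letter (u_word k (i - r)) = pi_letter (u_word k (i + n - r))"
    if "q \<le> i" "i \<le> q + n" "r \<le> k - 1" for i r
    using pi_eq[of "i - r"] that by (simp add: q_def)
  have u_eq: "u_word k i = u_word k (i + n)" if "q \<le> i" "i + 2 \<le> q + n" for i
  proof (rule pi_window_determines)
    show "\<forall>r \<le> k - 1. pi_letter (u_word k (i - r)) = pi_letter (u_word k (i + n - r))"
      using pi_left that by simp
    show "pi_letter (u_word k (i + 1)) = pi_letter (u_word k (i + n + 1))"
      "pi_letter (u_word k (i + 2)) = pi_letter (u_word k (i + n + 2))"
      using pi_eq[of "i + 1"] pi_eq[of "i + 2"] that by (simp_all add: q_def)
  qed (use that in \<open>simp_all add: q_def\<close>)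
  have n: "2 \<le> n" using assms(1) False by simp
  \<comment> \<open>Only \<open>m\<close> and \<open>m + 1\<close> remain undecided; there the left
    comparisons leave at most the ambiguity of \<open>pi_ambiguity\<close>.\<close>
  define m where "m = q + n - 1"
  have m: "q \<le> m" "Suc m = q + n" "q < m" using n by (simp_all add: m_def)
  have ambiguity: "\<forall>r \<le> k - 2. pi_letter (u_word k (i - r)) = pi_letter (u_word k (i + n - r))"
    if "q \<le> i" "i \<le> q + n" for i
    using pi_left that by simp
  show False
  proof (cases "u_word k m = u_word k (m + n)")
    case True
    have square: "u_word k i = u_word k (i + n)" if "q \<le> i" "i < q + n" for i
      using u_eq[of i] True that m by (cases "i = m") simp_all
    have "u_word k (q + n) \<noteq> u_word k (q + n + n)"
    proof
      assume eq: "u_word k (q + n) = u_word k (q + n + n)"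
      have "\<forall>i \<in> {q..q + n}. u_word k i = u_word k (i + n)"
      proof
        fix i assume "i \<in> {q..q + n}"
        then show "u_word k i = u_word k (i + n)"
          using square[of i] eq by (cases "i = q + n") simp_all
      qed
      then show False using assms(1) by (rule u_word_overlap_free)
    qed
    then show False
    proof (rule pi_ambiguity)
      show "\<forall>r \<le> k - 2. pi_letter (u_word k (q + n - r)) = pi_letter (u_word k (q + n + n - r))"
        by (rule ambiguity) simp_all
    next
      \<comment> \<open>Equal letters of positive index at \<open>q\<close> and \<open>q + n\<close>
        have equal predecessors, so the square extends left to an overlap.\<close>
      fix b j assume j: "0 < j" "u_word k (q + n) = lit b j"
      then have "u_word k q = lit b j" using square[of q] assms(1) by simp
      then have "1 \<le> q" "u_word k (q - 1) = lit b (j - 1)"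
        using u_word_block[of q b j 1] j by simp_all
      moreover have "u_word k (q + n - 1) = lit b (j - 1)"
        using u_word_block[of "q + n" b j 1] j by simp
      moreover have "q - 1 + n = q + n - 1" using \<open>1 \<le> q\<close> by simp
      ultimately have first: "u_word k (q - 1) = u_word k (q - 1 + n)" by simp
      have "\<forall>i \<in> {q - 1..q - 1 + n}. u_word k i = u_word k (i + n)"
      proof
        fix i assume "i \<in> {q - 1..q - 1 + n}"
        then have "i = q - 1 \<or> q \<le> i \<and> i < q + n" using \<open>1 \<le> q\<close> by auto
        then show "u_word k i = u_word k (i + n)" using first square by metis
      qed
      then show False using assms(1) by (rule u_word_overlap_free)
    next
      fix b j assume j: "0 < j" "u_word k (q + n + n) = lit b j" "u_word k (q + n) = lit (\<not> b) 0"
      have "u_word k q = lit (\<not> b) 0"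
        using square[of q] j(3) assms(1) by simp
      moreover have "u_word k (q + 2 * n) = lit b j"
        using j(2) by (simp add: mult_2 add.assoc)
      ultimately show False
        using square j(1) assms(1) by (intro u_word_no_square_extension[of q n b j]) simp_all
    qed
  next
    case False
    obtain m' where m': "m = Suc m'" using m by (cases m) auto
    have before: "u_word k m' = u_word k (m' + n)"
      using u_eq[of m'] m m' by simp
    have pi_right: "pi_letter (u_word k (m + 1)) = pi_letter (u_word k (m + n + 1))"
    proof -
      have "p \<le> m + 1" "m + 1 \<le> q + n" using m by (simp_all add: q_def)
      then show ?thesis using pi_eq[of "m + 1"] by simp
    qed
    from False show False
    proof (rule pi_ambiguity)
      show "\<forall>r \<le> k - 2. pi_letter (u_word k (m - r)) = pi_letter (u_word k (m + n - r))"
        by (rule ambiguity) (use m in simp_all)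
    next
      fix b j assume j: "0 < j" "j < k" "u_word k m = lit b j" "u_word k (m + n) = lit (\<not> b) 0"
      have m'_lit: "u_word k m' = lit b (j - 1)" using u_word_before[of m' b "j - 1"] j m' by simp
      have "u_word k (m + 1) = lit b 0"
        by (rule right_of_ambiguity(1)[of m b j "m' + n"])
          (use j m' m'_lit before pi_right in \<open>auto simp: next_letter_lit\<close>)
      then have q0: "u_word k q = lit b 0"
        using u_eq[of q] n m by simp
      have "j \<le> m - q"
      proof (rule ccontr)
        assume "\<not> j \<le> m - q"
        then have "u_word k (m - (m - q)) = lit b (j - (m - q))"
          using u_word_block[OF j(3), of "m - q"] by simp
        then show False using q0 m \<open>\<not> j \<le> m - q\<close> by simp
      qed
      \<comment> \<open>\<open>y\<close> starts the block ending at \<open>m\<close>. Its left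
        neighbour and the one \<open>n\<close> places later are forced to precede
        \<open>lit b j\<close> and \<open>lit b (j - 1)\<close> on the cycle, which is incompatible
        with the known equalities.\<close>
      then obtain y where y: "m = y + j" "q \<le> y"
        using m(1) by (intro that[of "m - j"]) simp_all
      have y_pos: "y = Suc (y - 1)" using y q_def k by simp
      have "next_letter k (u_word k (y - 1)) = lit b j"
        using u_word_block_neighbours[of "y - 1" j b] y y_pos j \<open>u_word k (m + 1) = lit b 0\<close>
        by (auto simp: next_letter_lit split: if_splits)
      moreover have "next_letter k (u_word k (y - 1 + n)) = lit b (j - 1)"
      proof -
        have index: "Suc (y - 1 + n) + (j - 1) = m' + n" "Suc (m' + n) = m + n"
          using y y_pos j(1) m' by simp_all
        then have "u_word k (Suc (y - 1 + n) + (j - 1)) = lit b (j - 1)"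
          using m'_lit before by (simp only:)
        from u_word_block_neighbours[OF this] show ?thesis
          unfolding index j(4) using j(1,2) by (auto simp: next_letter_lit split: if_splits)
      qed
      moreover have "next_letter k (lit b j) \<noteq> lit b (j - 1)"
        using j(1) by (auto simp: next_letter_lit)
      moreover have "y - 1 + n = m" if "y = q" using that y_pos m by simp
      moreover have "q \<le> y - 1 \<and> y - 1 + 2 \<le> q + n" if "y \<noteq> q" using that y y_pos m j(1) by simp
      ultimately show False
        using u_eq[of "y - 1"] j(1,3) by (cases "y = q") auto
    next
      fix b j assume j: "0 < j" "j < k" "u_word k (m + n) = lit b j" "u_word k m = lit (\<not> b) 0"
      have m'_lit: "u_word k m' = lit b (j - 1)"
        using u_word_before[of "m' + n" b "j - 1"] j m' before by simp
      have "u_word k (Suc m' + 1) = lit (\<not> b) 1"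
        by (rule right_of_ambiguity(2)[of "m + n" b j m'])
          (use j m' m'_lit pi_right in \<open>auto simp: next_letter_lit\<close>)
      then have "u_word k q = lit (\<not> b) 1"
        using u_eq[of q] n m m' by simp
      then have q1: "1 \<le> q" "u_word k (q - 1) = lit (\<not> b) 0"
        using u_word_block[of q "\<not> b" 1 1] by simp_all
      have "q - 1 + n = m" using q1(1) m by simp
      \<comment> \<open>Starting at \<open>q - 1\<close> instead of \<open>q\<close> completes the
        square: position \<open>m\<close> is \<open>q - 1 + n\<close>, and both carry
        \<open>lit (\<not> b) 0\<close>. The letter after the square is
        \<open>lit b j\<close>.\<close>
      show False
      proof (rule u_word_no_square_extension[of "q - 1" n b j])
        show "\<forall>i \<in> {q - 1..<q - 1 + n}. u_word k i = u_word k (i + n)"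
        proof
          fix i assume "i \<in> {q - 1..<q - 1 + n}"
          then show "u_word k i = u_word k (i + n)"
            using u_eq[of i] q1 j(4) m \<open>q - 1 + n = m\<close> by (cases "i = q - 1") auto
        qed
        have "q - 1 + 2 * n = m + n" using \<open>q - 1 + n = m\<close> by simp
        then show "u_word k (q - 1 + 2 * n) = lit b j" by (simp only: j)
      qed (use q1 j assms(1) in simp_all)
    qed
  qed
qed

subsection \<open>Critical exponents\<close>

lemma period_bound:
  assumes "is_factor z (x_word k)" "1 \<le> n" "z = prefix (length z) (v\<^sup>\<omega>)" "length v = n"
  shows "length z < 2 * n + k"
proof (rule ccontr)
  assume long: "\<not> length z < 2 * n + k"
  obtain p where p: "z = x_word k [p \<rightarrow> p + length z]"
    using assms(1) by (auto simp: is_factor_def)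
  have x: "pi_letter (u_word k (p + i)) = v ! (i mod n)" if "i < length z" for i
  proof -
    have "pi_letter (u_word k (p + i)) = z ! i"
      using that by (subst p) (simp add: x_word_def)
    also have "z ! i = v ! (i mod n)"
      using that assms(2,4) by (subst assms(3)) simp
    finally show ?thesis .
  qed
  have "pi_letter (u_word k (p + i)) = pi_letter (u_word k (p + i + n))" if "i < n + k" for i
    using x[of i] x[of "i + n"] that long by (simp add: add.assoc)
  then show False using no_long_pi_repetition assms(2) by blast
qed

text \<open>Dividing the bound \<open>2 * length v + (k - 1)\<close> on the length by the period
  leaves an excess over 2 that vanishes as \<open>N\<close> grows.\<close>

lemma exponent_bound:
  assumes "is_rat_power z v r" "is_factor z (x_word k)" "N \<le> length v" "1 \<le> N"
  shows "real_of_rat r \<le> 2 + real (k - 1) / real N"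
proof -
  have r: "real_of_rat r = real (length z) / real (length v)"
    using assms(1) by (simp add: is_rat_power_def of_rat_divide)
  have v: "1 \<le> length v" "v \<noteq> []" using assms(3,4) by auto
  have "length z \<le> 2 * length v + (k - 1)"
    using period_bound[OF assms(2) v(1)] assms(1) k by (force simp: is_rat_power_def)
  then have "real (length z) \<le> real (2 * length v + (k - 1))" by (simp only: of_nat_le_iff)
  then have "real_of_rat r \<le> (2 * real (length v) + real (k - 1)) / real (length v)"
    unfolding r by (intro divide_right_mono) simp_all
  also have "\<dots> = 2 + real (k - 1) / real (length v)"
    using v by (simp add: add_divide_distrib)
  also have "\<dots> \<le> 2 + real (k - 1) / real N"
    using assms(3,4) by (intro add_left_mono frac_le) simp_all
  finally show ?thesis .
qed

section \<open>Factors attaining the lower bounds\<close>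

lemma xi_power_run: "j < k \<Longrightarrow> (xi k ^^ j) [lit b 0] = map (lit b) [0..<Suc j]"
proof (induction j)
  case (Suc j)
  then show ?case using xi_run[of j b] by simp
qed simp

lemma xi_power_Suc_k:
  "(xi k ^^ Suc k) [lit b 0] = map (lit b) [0..<k] @ [lit (\<not> b) 0, lit (\<not> b) 0, lit (\<not> b) 1]"
  "(xi k ^^ k) [lit b 0] = map (lit b) [0..<k] @ [lit (\<not> b) 0]"
proof -
  obtain j where j: "k = Suc (Suc j)" using k by (intro that[of "k - 2"]) simp
  have run: "xi k (map (lit b) [0..<Suc j]) = map (lit b) [0..<k]"
    using xi_run[of j b] j by simp
  have "(xi k ^^ k) [lit b 0] = xi k (map (lit b) [0..<Suc (Suc j)])"
    using xi_power_run[of "Suc j" b] j by simp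
  also have "\<dots> = map (lit b) [0..<k] @ [lit (\<not> b) 0]"
    using run j by (simp add: xi_append xi_Cons xi_letter_lit)
  finally show 1: "(xi k ^^ k) [lit b 0] = map (lit b) [0..<k] @ [lit (\<not> b) 0]" .
  have "xi k (map (lit b) [0..<k]) = map (lit b) [0..<k] @ [lit (\<not> b) 0]"
    using run j by (simp add: xi_append xi_Cons xi_letter_lit)
  then show "(xi k ^^ Suc k) [lit b 0]
      = map (lit b) [0..<k] @ [lit (\<not> b) 0, lit (\<not> b) 0, lit (\<not> b) 1]"
    using 1 by (simp add: xi_append xi_Cons xi_letter_lit)
qed

text \<open>This word serves both lower bounds: dropping its first and last letters leaves
  \<open>k + 1\<close> letters with equal images, and it contains the square of
  \<open>lit (\<not> b) 0\<close>.\<close>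

lemma long_block_factor:
  obtains n where
    "iterate_factor k n (map (lit b) [0..<k] @ [lit (\<not> b) 0, lit (\<not> b) 0, lit (\<not> b) 1])"
proof -
  have "iterate_factor k 0 [lit False 0]"
    unfolding iterate_factor_def by (intro exI[of _ "[]"]) (simp add: Plain_eq_lit)
  moreover from this have "iterate_factor k (k + 0) [lit True 0]"
    using iterate_factor_xi_power[of k 0 "[lit False 0]" k] xi_power_Suc_k(2)[of False]
      iterate_factor_right[of k k "map (lit False) [0..<k]"] by simp
  ultimately obtain n where "iterate_factor k n [lit b 0]" by (cases b) auto
  then show ?thesis
    using iterate_factor_xi_power[of k n "[lit b 0]" "Suc k"] xi_power_Suc_k(1) that by simp
qed

lemma replicate_is_factor:
  assumes "a \<in> {0, 1}"
  shows "is_factor (replicate (k + 1) a) (x_word k)"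
proof -
  \<comment> \<open>With this choice \<open>a\<close> is the image of
    \<open>lit (\<not> b) 0\<close> and of every \<open>lit b j\<close> with
    \<open>j > 0\<close>.\<close>
  define b where "b \<longleftrightarrow> a = 0"
  obtain n where
    "iterate_factor k n (map (lit b) [0..<k] @ [lit (\<not> b) 0, lit (\<not> b) 0, lit (\<not> b) 1])"
    by (rule long_block_factor)
  moreover have "[0..<k] = 0 # [1..<k]" using k by (simp add: upt_conv_Cons)
  ultimately have "iterate_factor k n
      ([lit b 0] @ (map (lit b) [1..<k] @ [lit (\<not> b) 0, lit (\<not> b) 0]) @ [lit (\<not> b) 1])"
    by simp
  then have "iterate_factor k n (map (lit b) [1..<k] @ [lit (\<not> b) 0, lit (\<not> b) 0])"
    by (rule iterate_factor_middle)
  then have "is_factor (map pi_letter (map (lit b) [1..<k] @ [lit (\<not> b) 0, lit (\<not> b) 0])) (x_word k)"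
    by (rule iterate_factor_x_word)
  also have "map pi_letter (map (lit b) [1..<k] @ [lit (\<not> b) 0, lit (\<not> b) 0]) = replicate (k + 1) a"
  proof (rule nth_equalityI)
    fix i assume "i < length (map pi_letter (map (lit b) [1..<k] @ [lit (\<not> b) 0, lit (\<not> b) 0]))"
    then have "i < k + 1" using k by simp
    then consider "i < k - 1" | "i = k - 1" | "i = k" by linarith
    then show "map pi_letter (map (lit b) [1..<k] @ [lit (\<not> b) 0, lit (\<not> b) 0]) ! i
        = replicate (k + 1) a ! i"
      using assms k by cases (auto simp: nth_append pi_letter_lit b_def simp del: replicate_Suc)
  qed (use k in simp)
  finally show ?thesis .
qed

text \<open>The iterates of \<open>xi\<close> turn the factor \<open>[Plain 0, Plain 0]\<close> into
  squares of unbounded period, and \<open>pi_letter\<close> preserves squares.\<close>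

lemma two_le_exponent_sup_from: "2 \<le> exponent_sup_from (x_word k) N"
proof -
  let ?z = "(xi k ^^ N) [Plain 0]"
  let ?w = "map pi_letter ?z"
  obtain n where
    "iterate_factor k n (map (lit True) [0..<k] @ [Plain 0, Plain 0, Plain 1])"
    using long_block_factor[of True] by (auto simp: Plain_eq_lit)
  then have "iterate_factor k n ([Plain 0] @ [Plain 0])"
    using iterate_factor_middle[of k n "map (lit True) [0..<k]" "[Plain 0, Plain 0]"] by simp
  then have "iterate_factor k (N + n) (?z @ ?z)"
    using iterate_factor_xi_power[of k n "[Plain 0] @ [Plain 0]" N]
      xi_power_append[of N k "[Plain 0]" "[Plain 0]"] by simp
  then have "is_factor (?w @ ?w) (x_word k)"
    using iterate_factor_x_word by fastforce
  moreover have len: "N < length ?w" using length_xi_iterate[of N k] by simp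
  moreover from len have "?w \<noteq> []" by auto
  moreover from this have "is_rat_power (?w @ ?w) ?w 2" by (rule square_is_rat_power)
  ultimately have "ereal (real_of_rat 2) \<le> exponent_sup_from (x_word k) N"
    unfolding exponent_sup_from_def
    by (intro Sup_upper CollectI exI[of _ "2 :: rat"] exI[of _ ?w] exI[of _ "?w @ ?w"]) auto
  then show ?thesis by simp
qed

section \<open>Values of the exponents\<close>

lemma exponent_sup_from_le:
  assumes "1 \<le> N"
  shows "exponent_sup_from (x_word k) N \<le> ereal (2 + real (k - 1) / real N)"
  unfolding exponent_sup_from_def
  using exponent_bound assms by (intro Sup_least) auto

lemma asymptotic_exponent: "asymptotic_critical_exponent (x_word k) = 2"
proof -
  have "(\<lambda>N. 2 + real (k - 1) / real N) \<longlonglongrightarrow> 2 + 0"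
    by (intro tendsto_add tendsto_const lim_const_over_n)
  then have "(\<lambda>N. ereal (2 + real (k - 1) / real N)) \<longlonglongrightarrow> ereal (2 + 0)"
    by (rule tendsto_ereal)
  then have upper: "(\<lambda>N. ereal (2 + real (k - 1) / real N)) \<longlonglongrightarrow> 2"
    by simp
  have le: "\<forall>\<^sub>F N in sequentially.
      exponent_sup_from (x_word k) N \<le> ereal (2 + real (k - 1) / real N)"
    by (rule eventually_sequentiallyI[of 1]) (rule exponent_sup_from_le)
  have "exponent_sup_from (x_word k) \<longlonglongrightarrow> 2"
    using always_eventually[OF allI[OF two_le_exponent_sup_from]] le tendsto_const upper
    by (rule tendsto_sandwich)
  then show ?thesis
    using asymptotic_critical_exponent_tendsto LIMSEQ_unique by blast
qed

lemma critical_exponent_eq: "critical_exponent (x_word k) = ereal (real (k + 1))"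
proof (rule antisym)
  have "real_of_rat r \<le> real (k + 1)" if "is_rat_power z v r" "is_factor z (x_word k)" for r v z
  proof -
    have "1 \<le> length v" using that(1) by (cases v) (auto simp: is_rat_power_def)
    \<comment> \<open>Period 1 is the worst case, giving \<open>2 + (k - 1)\<close>.\<close>
    then show ?thesis using exponent_bound[OF that, of 1] k by (simp add: of_nat_diff)
  qed
  then show "critical_exponent (x_word k) \<le> ereal (real (k + 1))"
    unfolding critical_exponent_def by (intro Sup_least) auto
  have "ereal (real_of_rat (of_nat (k + 1))) \<le> critical_exponent (x_word k)"
    unfolding critical_exponent_def
    by (intro Sup_upper CollectI exI[of _ "of_nat (k + 1) :: rat"] exI[of _ "[0 :: nat]"]
        exI[of _ "replicate (k + 1) (0 :: nat)"] conjI refl replicate_is_rat_power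
        replicate_is_factor) simp_all
  then show "ereal (real (k + 1)) \<le> critical_exponent (x_word k)"
    by (simp only: of_rat_of_nat_eq)
qed

end

theorem theorem4:
  fixes k :: nat
  assumes "k \<ge> 4"
  shows "critical_exponent (x_word k) = ereal (real (k + 1))
    \<and> (\<forall>a \<in> {0, 1}. is_factor (replicate (k + 1) a) (x_word k)
          \<and> is_rat_power (replicate (k + 1) a) [a] (of_nat (k + 1)))
    \<and> \<not> (\<exists>n z. n \<ge> 1 \<and> is_factor z (x_word k) \<and> length z = 2 * n + k \<and> has_period z n)
    \<and> asymptotic_critical_exponent (x_word k) = 2"
proof (intro conjI ballI notI)
  assume "\<exists>n z. n \<ge> 1 \<and> is_factor z (x_word k) \<and> length z = 2 * n + k \<and> has_period z n"
  then obtain n z v where "n \<ge> 1" "is_factor z (x_word k)" "length z = 2 * n + k"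
    "z = prefix (length z) (v\<^sup>\<omega>)" "length v = n"
    by (auto simp: has_period_def)
  then show False using period_bound[OF assms, of z n v] by simp
next
  show "critical_exponent (x_word k) = ereal (real (k + 1))"
    using assms by (rule critical_exponent_eq)
  show "asymptotic_critical_exponent (x_word k) = 2"
    using assms by (rule asymptotic_exponent)
next
  fix a :: nat assume "a \<in> {0, 1}"
  with assms show "is_factor (replicate (k + 1) a) (x_word k)"
    by (rule replicate_is_factor)
  show "is_rat_power (replicate (k + 1) a) [a] (of_nat (k + 1))"
    by (rule replicate_is_rat_power)
qed

end
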